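(* Let $G$ be a finite abelian group of order $v$ and let $S \subseteq G$ be a $(v,k,\mu)$ sum set. Then $S$ is reversible, i.e. $S = S^{(-1)}$.
   Context: For $a \in G$, the number of ways to write $a$ as a product in $S$ is the number of ordered pairs $(x,y) \in S\times S$ with $xy = a$. $S$ with $|S|=k$ is a $(v,k,\mu)$ sum set if every nonidentity element of $G$ can be written as a product in $S$ in exactly $\mu$ ways. $S^{(-1)} = \{s^{-1} : s \in S\}$. *)

theory Defs
  imports "HOL-Algebra.Coset"
begin

definition product_reps :: "('a, 'b) monoid_scheme \<Rightarrow> 'a set \<Rightarrow> 'a \<Rightarrow> nat" where
  "product_reps G S a = card {(x, y). x \<in> S \<and> y \<in> S \<and> x \<otimes>\<^bsub>G\<^esub> y = a}"

definition sum_set :: "('a, 'b) monoid_scheme \<Rightarrow> 'a set \<Rightarrow> nat \<Rightarrow> nat \<Rightarrow> nat \<Rightarrow> bool" where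
  "sum_set G S v k \<mu> \<longleftrightarrow>
     group G \<and> finite (carrier G) \<and> order G = v \<and> S \<subseteq> carrier G \<and> card S = k \<and>
     (\<forall>a \<in> carrier G - {\<one>\<^bsub>G\<^esub>}. product_reps G S a = \<mu>)"

definition reversible :: "('a, 'b) monoid_scheme \<Rightarrow> 'a set \<Rightarrow> bool" where
  "reversible G S \<longleftrightarrow> S = set_inv\<^bsub>G\<^esub> S"

end

theory Submission
  imports Defs Complex_Main
begin

text \<open>
  Let \<open>A f x = (\<Sum>s\<in>S. f (x s))\<close> and \<open>B f x = (\<Sum>s\<in>S. f (x s\<inverse>))\<close>; these operators on real functions
  commute and are adjoint to each other. The sum set equation says that \<open>A\<^sup>2 = B\<^sup>2 = n\<close> on functions
  of sum zero, where \<open>n\<close> is the number of representations of the identity minus \<open>\<mu>\<close>.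
  For such \<open>f\<close> and \<open>e = \<plusminus>1\<close>, the function \<open>g = A f + e B f\<close> satisfies \<open>A g = e B g\<close>, hence
  \<open>\<parallel>A g\<parallel>\<^sup>2 = e \<langle>A g, B g\<rangle> = e n \<parallel>g\<parallel>\<^sup>2\<close>. If \<open>e n \<le> 0\<close>, this forces \<open>A g = B g = 0\<close>, and then
  \<open>\<parallel>g\<parallel>\<^sup>2 = \<langle>f, B g + e A g\<rangle> = 0\<close>. Now take \<open>f\<close> to be the point mass at the identity
  minus its mean.
  If \<open>n \<ge> 0\<close>, then \<open>e = -1\<close> gives \<open>S = S\<inverse>\<close> directly. If \<open>n < 0\<close>, then \<open>e = 1\<close> shows that the
  indicator functions of \<open>S\<close> and \<open>S\<inverse>\<close> add up to a constant; they agree at the identity, so this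
  constant is 0 or 2, and \<open>S\<close> is empty or the whole group.
\<close>

lemma (in group) sum_translate:
  fixes f :: "'a \<Rightarrow> real"
  assumes "a \<in> carrier G"
  shows "(\<Sum>x\<in>carrier G. f (x \<otimes> a)) = (\<Sum>x\<in>carrier G. f x)"
  by (rule sum.reindex_bij_witness[of _ "\<lambda>x. x \<otimes> inv a" "\<lambda>x. x \<otimes> a"])
     (use assms in \<open>auto simp: m_assoc\<close>)

lemma (in group) sum_translate_left:
  fixes f :: "'a \<Rightarrow> real"
  assumes "a \<in> carrier G"
  shows "(\<Sum>x\<in>carrier G. f (a \<otimes> x)) = (\<Sum>x\<in>carrier G. f x)"
  by (rule sum.reindex_bij_witness[of _ "\<lambda>x. inv a \<otimes> x" "\<lambda>x. a \<otimes> x"])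
     (use assms in \<open>auto simp: m_assoc[symmetric]\<close>)

lemma (in group) sum_inverse:
  fixes f :: "'a \<Rightarrow> real"
  shows "(\<Sum>x\<in>carrier G. f (inv x)) = (\<Sum>x\<in>carrier G. f x)"
  by (rule sum.reindex_bij_witness[of _ "\<lambda>x. inv x" "\<lambda>x. inv x"]) auto

text \<open>Right convolution with the indicator function of the set of inverses of
  \<open>S\<close>; \<open>inv_shift_sum\<close> is right convolution with that of \<open>S\<close>
  itself.\<close>

definition shift_sum :: "('a, 'b) monoid_scheme \<Rightarrow> 'a set \<Rightarrow> ('a \<Rightarrow> real) \<Rightarrow> 'a \<Rightarrow> real" where
  "shift_sum G S f x = (\<Sum>s\<in>S. f (x \<otimes>\<^bsub>G\<^esub> s))"

definition inv_shift_sum :: "('a, 'b) monoid_scheme \<Rightarrow> 'a set \<Rightarrow> ('a \<Rightarrow> real) \<Rightarrow> 'a \<Rightarrow> real" where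
  "inv_shift_sum G S f x = (\<Sum>s\<in>S. f (x \<otimes>\<^bsub>G\<^esub> inv\<^bsub>G\<^esub> s))"

text \<open>For each fixed \<open>s\<close>, substituting \<open>x \<otimes> inv s\<close> for
  \<open>x\<close> moves the translation from \<open>f\<close> to \<open>g\<close>.\<close>

lemma (in group) shift_sum_adjoint:
  assumes S: "S \<subseteq> carrier G"
  shows "(\<Sum>x\<in>carrier G. shift_sum G S f x * g x) = (\<Sum>x\<in>carrier G. f x * inv_shift_sum G S g x)"
proof -
  have "(\<Sum>x\<in>carrier G. shift_sum G S f x * g x) = (\<Sum>s\<in>S. \<Sum>x\<in>carrier G. f (x \<otimes> s) * g x)"
    unfolding shift_sum_def sum_distrib_right by (rule sum.swap)
  also have "\<dots> = (\<Sum>s\<in>S. \<Sum>x\<in>carrier G. f x * g (x \<otimes> inv s))"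
  proof (rule sum.cong[OF refl])
    fix s assume "s \<in> S"
    then have s: "s \<in> carrier G" using S by auto
    have "(\<Sum>x\<in>carrier G. f (x \<otimes> s) * g x)
        = (\<Sum>x\<in>carrier G. f (x \<otimes> s) * g ((x \<otimes> s) \<otimes> inv s))"
      using s by (intro sum.cong) (auto simp: m_assoc)
    also have "\<dots> = (\<Sum>x\<in>carrier G. f x * g (x \<otimes> inv s))"
      using sum_translate[OF s, of "\<lambda>x. f x * g (x \<otimes> inv s)"] .
    finally show "(\<Sum>x\<in>carrier G. f (x \<otimes> s) * g x) = (\<Sum>x\<in>carrier G. f x * g (x \<otimes> inv s))" .
  qed
  also have "\<dots> = (\<Sum>x\<in>carrier G. f x * inv_shift_sum G S g x)"
    unfolding inv_shift_sum_def sum_distrib_left by (rule sum.swap)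
  finally show ?thesis .
qed

text \<open>Both operators are sums of translations, and translations of an abelian group
  commute.\<close>

lemma (in comm_group) shift_sum_commute:
  assumes S: "S \<subseteq> carrier G" and x: "x \<in> carrier G"
  shows "shift_sum G S (inv_shift_sum G S f) x = inv_shift_sum G S (shift_sum G S f) x"
proof -
  have "shift_sum G S (inv_shift_sum G S f) x = (\<Sum>s\<in>S. \<Sum>t\<in>S. f (x \<otimes> inv t \<otimes> s))"
    unfolding shift_sum_def inv_shift_sum_def
  proof (intro sum.cong refl)
    fix s t assume "s \<in> S" "t \<in> S"
    then have "s \<in> carrier G" "t \<in> carrier G" using S by auto
    then show "f (x \<otimes> s \<otimes> inv t) = f (x \<otimes> inv t \<otimes> s)"
      using x by (simp add: m_ac)
  qed
  also have "\<dots> = inv_shift_sum G S (shift_sum G S f) x"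
    unfolding shift_sum_def inv_shift_sum_def by (rule sum.swap)
  finally show ?thesis .
qed

text \<open>The group ring form of the sum set condition, tested against \<open>h\<close>: group the
  pairs by their product. Each fibre over a nonidentity element has size \<open>\<mu>\<close>; the
  last term corrects the fibre over \<open>\<one>\<close>.\<close>

lemma sum_set_sum_products:
  fixes h :: "'a \<Rightarrow> real" and G (structure)
  assumes ss: "sum_set G S v k \<mu>"
  shows "(\<Sum>s\<in>S. \<Sum>t\<in>S. h (s \<otimes> t))
       = real \<mu> * (\<Sum>a\<in>carrier G. h a) + (real (product_reps G S \<one>) - real \<mu>) * h \<one>"
proof -
  interpret group G using ss by (simp add: sum_set_def)
  have fin: "finite (carrier G)" and S: "S \<subseteq> carrier G"
    and reps: "\<And>a. a \<in> carrier G - {\<one>} \<Longrightarrow> product_reps G S a = \<mu>"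
    using ss by (auto simp: sum_set_def)
  have finS: "finite S" using fin S finite_subset by blast
  have "(\<Sum>s\<in>S. \<Sum>t\<in>S. h (s \<otimes> t)) = (\<Sum>p\<in>S \<times> S. h (fst p \<otimes> snd p))"
    by (simp add: sum.cartesian_product case_prod_beta)
  also have "\<dots> = (\<Sum>a\<in>carrier G. \<Sum>p\<in>{p \<in> S \<times> S. fst p \<otimes> snd p = a}. h (fst p \<otimes> snd p))"
    by (rule sum.group[symmetric]) (use fin finS S in \<open>auto simp: subset_iff\<close>)
  also have "\<dots> = (\<Sum>a\<in>carrier G. real (product_reps G S a) * h a)"
  proof (rule sum.cong[OF refl])
    fix a
    have "{p \<in> S \<times> S. fst p \<otimes> snd p = a} = {(x, y). x \<in> S \<and> y \<in> S \<and> x \<otimes> y = a}" by auto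
    then have "product_reps G S a = card {p \<in> S \<times> S. fst p \<otimes> snd p = a}"
      by (simp add: product_reps_def)
    then show "(\<Sum>p\<in>{p \<in> S \<times> S. fst p \<otimes> snd p = a}. h (fst p \<otimes> snd p))
        = real (product_reps G S a) * h a"
      by simp
  qed
  also have "\<dots> = (\<Sum>a\<in>carrier G - {\<one>}. real \<mu> * h a) + real (product_reps G S \<one>) * h \<one>"
    using fin reps by (simp add: sum.remove[of _ \<one>])
  also have "\<dots> = real \<mu> * (\<Sum>a\<in>carrier G. h a) + (real (product_reps G S \<one>) - real \<mu>) * h \<one>"
    using fin by (simp add: sum.remove[of _ \<one> h] sum_distrib_left algebra_simps)
  finally show ?thesis .
qed

text \<open>Apply the product formula to the translate of \<open>f\<close> by \<open>x\<close>: its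
  total is still zero, so the \<open>\<mu>\<close> term vanishes.\<close>

lemma sum_set_shift_sum_twice:
  fixes G (structure)
  assumes ss: "sum_set G S v k \<mu>" and f: "(\<Sum>a\<in>carrier G. f a) = 0" and x: "x \<in> carrier G"
  shows "shift_sum G S (shift_sum G S f) x = (real (product_reps G S \<one>) - real \<mu>) * f x"
proof -
  interpret group G using ss by (simp add: sum_set_def)
  have S: "S \<subseteq> carrier G" using ss by (simp add: sum_set_def)
  have "shift_sum G S (shift_sum G S f) x = (\<Sum>s\<in>S. \<Sum>t\<in>S. f (x \<otimes> (s \<otimes> t)))"
    unfolding shift_sum_def using S x by (intro sum.cong) (auto simp: m_assoc subset_iff)
  then show ?thesis
    using sum_set_sum_products[OF ss, of "\<lambda>a. f (x \<otimes> a)"] f x by (simp add: sum_translate_left)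
qed

text \<open>Since inversion is a homomorphism here, the representation counts of \<open>S\<close>
  also govern products of inverses.\<close>

lemma (in comm_group) sum_set_inv_shift_sum_twice:
  assumes ss: "sum_set G S v k \<mu>" and f: "(\<Sum>a\<in>carrier G. f a) = 0" and x: "x \<in> carrier G"
  shows "inv_shift_sum G S (inv_shift_sum G S f) x = (real (product_reps G S \<one>) - real \<mu>) * f x"
proof -
  have S: "S \<subseteq> carrier G" using ss by (simp add: sum_set_def)
  have "inv_shift_sum G S (inv_shift_sum G S f) x = (\<Sum>s\<in>S. \<Sum>t\<in>S. f (x \<otimes> inv (s \<otimes> t)))"
    unfolding inv_shift_sum_def using S x
    by (intro sum.cong) (auto simp: m_assoc inv_mult subset_iff)
  moreover have "(\<Sum>a\<in>carrier G. f (x \<otimes> inv a)) = 0"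
    using sum_inverse[of "\<lambda>a. f (x \<otimes> a)"] sum_translate_left[OF x, of f] f by simp
  ultimately show ?thesis
    using sum_set_sum_products[OF ss, of "\<lambda>a. f (x \<otimes> inv a)"] x by simp
qed

lemma (in comm_group) sum_set_signed_shift_sum_eq_0:
  fixes e :: real
  assumes ss: "sum_set G S v k \<mu>" and f: "(\<Sum>a\<in>carrier G. f a) = 0"
    and e: "e\<^sup>2 = 1" and sign: "e * (real (product_reps G S \<one>) - real \<mu>) \<le> 0"
    and x: "x \<in> carrier G"
  shows "shift_sum G S f x + e * inv_shift_sum G S f x = 0"
proof -
  define n where "n = real (product_reps G S \<one>) - real \<mu>"
  let ?A = "shift_sum G S" and ?B = "inv_shift_sum G S"
  define g where "g = (\<lambda>x. ?A f x + e * ?B f x)"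
  have fin: "finite (carrier G)" and S: "S \<subseteq> carrier G"
    using ss by (auto simp: sum_set_def)
  have Ag: "?A g y = ?A (?A f) y + e * ?A (?B f) y" for y
    by (simp add: g_def shift_sum_def sum.distrib sum_distrib_left)
  have Bg: "?B g y = ?B (?A f) y + e * ?B (?B f) y" for y
    by (simp add: g_def inv_shift_sum_def sum.distrib sum_distrib_left)
  \<comment> \<open>With \<open>e\<^sup>2 = 1\<close>, both sides equal
    \<open>n * f y + e * ?A (?B f) y\<close>.\<close>
  have AgBg: "?A g y = e * ?B g y" if y: "y \<in> carrier G" for y
  proof -
    have "e * (e * z) = z" for z
      using e by (simp add: power2_eq_square flip: mult.assoc)
    then show ?thesis
      unfolding Ag Bg sum_set_shift_sum_twice[OF ss f y] sum_set_inv_shift_sum_twice[OF ss f y]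
        shift_sum_commute[OF S y] by (simp add: distrib_left)
  qed
  \<comment> \<open>Summing is pairing with the constant 1, which both operators multiply by
    \<open>card S\<close>; so they preserve sum zero, and the formula for \<open>?A\<close> applied
    twice is available for \<open>g\<close> too.\<close>
  have sumA: "(\<Sum>y\<in>carrier G. ?A f y) = 0"
    using shift_sum_adjoint[OF S, of f "\<lambda>_. 1"] f
    by (simp add: inv_shift_sum_def flip: sum_distrib_right)
  have sumB: "(\<Sum>y\<in>carrier G. ?B f y) = 0"
    using shift_sum_adjoint[OF S, of "\<lambda>_. 1" f] f
    by (simp add: shift_sum_def flip: sum_distrib_left)
  have sumg: "(\<Sum>y\<in>carrier G. g y) = 0"
    by (simp add: g_def sum.distrib sumA sumB flip: sum_distrib_left)
  have "(\<Sum>y\<in>carrier G. (?A g y)\<^sup>2) = e * (\<Sum>y\<in>carrier G. ?A g y * ?B g y)"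
    unfolding sum_distrib_left by (intro sum.cong) (auto simp: AgBg power2_eq_square)
  also have "(\<Sum>y\<in>carrier G. ?A g y * ?B g y) = (\<Sum>y\<in>carrier G. ?A (?A g) y * g y)"
    by (rule shift_sum_adjoint[OF S, symmetric])
  also have "\<dots> = n * (\<Sum>y\<in>carrier G. (g y)\<^sup>2)"
    unfolding sum_distrib_left
    by (intro sum.cong) (auto simp: sum_set_shift_sum_twice[OF ss sumg] n_def power2_eq_square)
  finally have "(\<Sum>y\<in>carrier G. (?A g y)\<^sup>2) = (e * n) * (\<Sum>y\<in>carrier G. (g y)\<^sup>2)" by simp
  also have "\<dots> \<le> 0"
    by (rule mult_nonpos_nonneg) (use sign in \<open>simp_all add: n_def sum_nonneg\<close>)
  finally have "(\<Sum>y\<in>carrier G. (?A g y)\<^sup>2) = 0"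
    by (intro antisym sum_nonneg) auto
  then have A0: "?A g y = 0" if "y \<in> carrier G" for y
    using that fin by (simp add: sum_nonneg_eq_0_iff)
  \<comment> \<open>Division by \<open>e\<close> is possible because
    \<open>e\<^sup>2 = 1\<close>.\<close>
  have B0: "?B g y = 0" if "y \<in> carrier G" for y
    using AgBg[OF that] A0[OF that] e by auto
  have "(\<Sum>y\<in>carrier G. (g y)\<^sup>2)
      = (\<Sum>y\<in>carrier G. ?A f y * g y) + e * (\<Sum>y\<in>carrier G. g y * ?B f y)"
    by (simp add: g_def power2_eq_square algebra_simps sum.distrib sum_distrib_left)
  also have "\<dots> = (\<Sum>y\<in>carrier G. f y * ?B g y) + e * (\<Sum>y\<in>carrier G. ?A g y * f y)"
    using shift_sum_adjoint[OF S] by metis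
  also have "\<dots> = 0" by (simp add: A0 B0)
  finally have "g x = 0"
    using x fin by (simp add: sum_nonneg_eq_0_iff)
  then show ?thesis by (simp add: g_def)
qed

text \<open>Only \<open>s = inv x\<close> hits the point mass, so the operator detects membership of
  \<open>inv x\<close> in \<open>S\<close>, up to a constant independent of
  \<open>x\<close>.\<close>

lemma (in group) shift_sum_centred_point_mass:
  assumes "finite S" "S \<subseteq> carrier G" "x \<in> carrier G"
  shows "shift_sum G S (\<lambda>y. of_bool (y = \<one>) - c) x = of_bool (inv x \<in> S) - real (card S) * c"
proof -
  have "x \<otimes> s = \<one> \<longleftrightarrow> s = inv x" if "s \<in> S" for s
    using assms that by (metis inv_equality inv_inv l_inv r_inv subsetD inv_closed inv_unique')
  then have "(\<Sum>s\<in>S. of_bool (x \<otimes> s = \<one>) :: real) = (\<Sum>s\<in>S. of_bool (s = inv x))"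
    by (intro sum.cong) auto
  also have "\<dots> = of_bool (inv x \<in> S)"
    using assms by (simp add: of_bool_def)
  finally show ?thesis
    by (simp add: shift_sum_def sum_subtractf)
qed

lemma (in group) inv_shift_sum_centred_point_mass:
  assumes "finite S" "S \<subseteq> carrier G" "x \<in> carrier G"
  shows "inv_shift_sum G S (\<lambda>y. of_bool (y = \<one>) - c) x = of_bool (x \<in> S) - real (card S) * c"
proof -
  have "x \<otimes> inv s = \<one> \<longleftrightarrow> s = x" if "s \<in> S" for s
    using assms that by (metis inv_equality inv_inv r_inv subsetD inv_closed)
  then have "(\<Sum>s\<in>S. of_bool (x \<otimes> inv s = \<one>) :: real) = (\<Sum>s\<in>S. of_bool (s = x))"
    by (intro sum.cong) auto
  also have "\<dots> = of_bool (x \<in> S)"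
    using assms by (simp add: of_bool_def)
  finally show ?thesis
    by (simp add: inv_shift_sum_def sum_subtractf)
qed

lemma (in group) reversibleI:
  assumes "S \<subseteq> carrier G" and "\<And>x. x \<in> carrier G \<Longrightarrow> inv x \<in> S \<longleftrightarrow> x \<in> S"
  shows "reversible G S"
proof -
  have "S \<subseteq> set_inv S"
  proof
    fix x assume "x \<in> S"
    then have "inv x \<in> S" "x = inv (inv x)" using assms by auto
    then show "x \<in> set_inv S" unfolding SET_INV_def by blast
  qed
  moreover have "set_inv S \<subseteq> S"
    using assms by (auto simp: SET_INV_def)
  ultimately show ?thesis by (auto simp: reversible_def)
qed

theorem theorem4p4:
  fixes G :: "('a, 'b) monoid_scheme" and S :: "'a set" and v k \<mu> :: nat
  assumes "comm_group G"
    and "finite (carrier G)"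
    and "order G = v"
    and "S \<subseteq> carrier G"
    and "sum_set G S v k \<mu>"
  shows "reversible G S"
proof -
  interpret comm_group G by fact
  note ss = assms(5)
  have finS: "finite S" using assms(2,4) finite_subset by blast
  define c where "c = 1 / real (card (carrier G))"
  define f :: "'a \<Rightarrow> real" where "f = (\<lambda>y. of_bool (y = \<one>\<^bsub>G\<^esub>) - c)"
  \<comment> \<open>Thus \<open>c\<close> is not a division by zero but the true mean of the point
    mass.\<close>
  have "card (carrier G) \<noteq> 0"
    using assms(2) one_closed by (metis card_0_eq empty_iff)
  then have f: "(\<Sum>a\<in>carrier G. f a) = 0"
    using assms(2) by (simp add: f_def c_def sum_subtractf of_bool_def)
  note A = shift_sum_centred_point_mass[OF finS assms(4), of _ c, folded f_def]
  note B = inv_shift_sum_centred_point_mass[OF finS assms(4), of _ c, folded f_def]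
  show ?thesis
  proof (rule reversibleI[OF assms(4)])
    fix x assume x: "x \<in> carrier G"
    show "inv\<^bsub>G\<^esub> x \<in> S \<longleftrightarrow> x \<in> S"
    proof (cases "real (product_reps G S \<one>\<^bsub>G\<^esub>) - real \<mu> \<ge> 0")
      case True
      then have "shift_sum G S f x + (-1) * inv_shift_sum G S f x = 0"
        by (intro sum_set_signed_shift_sum_eq_0[OF ss f _ _ x]) auto
      \<comment> \<open>The constants \<open>real (card S) * c\<close> cancel, leaving equality of
        the two indicators.\<close>
      then show ?thesis using x by (simp add: A B of_bool_def split: if_splits)
    next
      case False
      then have "shift_sum G S f y + 1 * inv_shift_sum G S f y = 0" if "y \<in> carrier G" for y
        by (intro sum_set_signed_shift_sum_eq_0[OF ss f _ _ that]) auto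
      \<comment> \<open>At \<open>\<one>\<close> both indicators coincide, so their constant sum is
        0 or 2; at \<open>x\<close> they must then coincide as well.\<close>
      from this[OF x] this[OF one_closed] show ?thesis
        using x by (simp add: A B of_bool_def split: if_splits)
    qed
  qed
qed

end
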